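(* Let $\omega\in(0,1]$, let the randomized compression operator $Q$ satisfy $\mathbb{E}\lVert Q(\mathbf{x})-\mathbf{x}\rVert^2\le(1-\omega)\lVert\mathbf{x}\rVert^2$ for all $\mathbf{x}\in\mathbb{R}^d$, let $\mathbf{W},\boldsymbol{\phi},\delta,C,\kappa,\beta$ be as in the context, and set $$\gamma:=\frac{2\omega\delta}{8\beta\delta+4\beta^2C+4\omega\delta^2},$$ where it is required that $\gamma\in(0,1]$. Let $\mathbf{X}(0)\in\mathbb{R}^{n\times d}$ be arbitrary, $\hat{\mathbf{X}}(0)=\mathbf{0}$, $\mathbf{y}(0)=\mathbf{1}$, and for $t\ge 0$ let $$\hat{\mathbf{X}}(t+1)=\hat{\mathbf{X}}(t)+Q(\mathbf{X}(t)-\hat{\mathbf{X}}(t)),\qquad \mathbf{X}(t+1)=\mathbf{X}(t)+\gamma(\mathbf{W}-\mathbf{I})\hat{\mathbf{X}}(t+1),$$ $$\mathbf{y}(t+1)=\mathbf{W}\mathbf{y}(t),\qquad \mathbf{z}_i(t+1)=\frac{\mathbf{x}_i(t+1)}{y_i(t+1)}\quad (i\in[n]).$$ Let $\mathbf{Z}(t)=[\mathbf{z}_1(t),\dots,\mathbf{z}_n(t)]^\top$ and let $\overline{\mathbf{X}}(0)=\frac{1}{n}\mathbf{1}\mathbf{1}^\top\mathbf{X}(0)$. Then for all $t\ge1$, $$\mathbb{E}\big\lVert\mathbf{Z}(t)-\overline{\mathbf{X}}(0)\big\rVert_F\le C_0\,\rho^t,$$ where $$\rho:=1-\frac{\omega^2\delta^2}{16\beta\delta+8\beta^2C+8\omega\delta^2},\qquad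 C_0:=\frac{4nC(1+\beta C)\lVert\mathbf{X}(0)\rVert_F}{\kappa\delta}.$$
   Context: Notation: $[n]=\{1,\dots,n\}$; $\mathbf{1}\in\mathbb{R}^n$ is the all-ones vector, $\mathbf{I}$ the $n\times n$ identity; $\lVert\cdot\rVert$ is the Euclidean norm of a vector and the induced (spectral) norm of a square matrix, $\lVert\cdot\rVert_F$ the Frobenius norm. For $\mathbf{X}(t)\in\mathbb{R}^{n\times d}$ the $i$-th row is $\mathbf{x}_i(t)^\top$, and $y_i(t)$ is the $i$-th entry of $\mathbf{y}(t)\in\mathbb{R}^n$. Network and mixing matrix: $\mathcal{G}=([n],\mathcal{E})$ is a fixed, strongly connected directed graph. $\mathbf{W}\in[0,1]^{n\times n}$ is column stochastic ($\mathbf{1}^\top\mathbf{W}=\mathbf{1}^\top$) and consistent with $\mathcal{G}$ in the sense that, for $i\ne j$, $\mathbf{W}_{ij}=0$ whenever $(j,i)\notin\mathcal{E}$ (every node is counted among its own neighbors). Set $\beta=\lVert\mathbf{W}-\mathbf{I}\rVert$. Fix constants $\delta\in(0,1]$, $C,\kappa>0$ and a stochastic vector $\boldsymbol{\phi}\in\mathbb{R}^n$ (nonnegative entries, $\mathbf{1}^\top\boldsymbol{\phi}=1$) such that for all $t\ge0$ and $i\in[n]$: $\mathbf{W}\boldsymbol{\phi}=\boldsymbol{\phi}$, $[\mathbf{W}^t\mathbf{1}]_i\ge\kappa$, and $\lVert\mathbf{W}^t-\boldsymbol{\phi}\mathbf{1}^\top\rVert\le C(1-\delta)^t$ (with $\mathbf{W}^0=\mathbf{I}$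 and $0^0=1$). Compression: $Q$ is a randomized map $\mathbb{R}^d\to\mathbb{R}^d$ (formally $Q(\mathbf{x},\boldsymbol{\zeta},\omega)$ with random $\boldsymbol{\zeta}$, suppressed in notation), and the expectation in its defining inequality is over this internal randomness. A fresh independent realization of the randomness is used each time an agent applies $Q$. On matrices $Q$ acts row by row: $Q(\mathbf{X})=[Q(\mathbf{x}_1),\dots,Q(\mathbf{x}_n)]^\top$. $\mathbb{E}$ in the conclusion is over all randomness. *)

theory Defs
  imports
    "Graph_Theory.Digraph_Component"
    "HOL-Probability.Probability"
begin

(* A matrix with rows indexed by 'n and columns indexed by 'd has type real^'d^'n.

   Pitfall: on this type the library's "*", "^" and "1" are entrywise (1 is the all-ones matrix),
   so the powers of a matrix need a definition of their own. *)

primrec matrix_power :: "real^'n^'n \<Rightarrow> nat \<Rightarrow> real^'n^'n" where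
  "matrix_power A 0 = mat 1"
| "matrix_power A (Suc t) = A ** matrix_power A t"

abbreviation spectral_norm :: "real^'n^'n \<Rightarrow> real" where
  "spectral_norm A \<equiv> onorm (\<lambda>v. A *v v)"

(* The norm that the library puts on the type of matrices is the Frobenius norm. *)

lemma norm_matrix_frobenius:
  fixes A :: "real^'d^'n"
  shows "norm A = sqrt (\<Sum>i\<in>UNIV. \<Sum>j\<in>UNIV. (A $ i $ j)\<^sup>2)"
  by (simp add: norm_vec_def L2_set_def sum_nonneg)

(* Strong connectedness of the directed graph with vertex set UNIV and arc set E,
   where (j, i) is the arc from j to i. *)

abbreviation strongly_connected_arcs :: "('n \<times> 'n) set \<Rightarrow> bool" where
  "strongly_connected_arcs E \<equiv> strongly_connected (with_proj \<lparr>pverts = UNIV, parcs = E\<rparr>)"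

(* A randomized map is a jointly measurable map Q of the point x and of a random seed with law S.
   The contraction property includes integrability, because the Bochner integral of a
   non-integrable function is 0. *)

definition randomized_compressor ::
    "real \<Rightarrow> 'z measure \<Rightarrow> (real^'d \<Rightarrow> 'z \<Rightarrow> real^'d) \<Rightarrow> bool" where
  "randomized_compressor \<omega> S Q \<longleftrightarrow>
     prob_space S \<and>
     (\<lambda>(x, s). Q x s) \<in> borel \<Otimes>\<^sub>M S \<rightarrow>\<^sub>M borel \<and>
     (\<forall>x. integrable S (\<lambda>s. (norm (Q x s - x))\<^sup>2) \<and>
          (\<integral>s. (norm (Q x s - x))\<^sup>2 \<partial>S) \<le> (1 - \<omega>) * (norm x)\<^sup>2)"

(* Row i of the matrix is compressed with its own seed s i. *)

definition compress_rows ::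
    "(real^'d \<Rightarrow> 'z \<Rightarrow> real^'d) \<Rightarrow> real^'d^'n \<Rightarrow> ('n \<Rightarrow> 'z) \<Rightarrow> real^'d^'n" where
  "compress_rows Q A s = (\<chi> i. Q (A $ i) (s i))"

(* All seeds are independent and have law S; \<zeta> (t, i) is the one used by agent i in the step
   from time t to time t + 1. *)

definition fresh_seeds ::
    "'a measure \<Rightarrow> 'z measure \<Rightarrow> (nat \<times> 'n \<Rightarrow> 'a \<Rightarrow> 'z) \<Rightarrow> bool" where
  "fresh_seeds M S \<zeta> \<longleftrightarrow>
     prob_space.indep_vars M (\<lambda>_. S) \<zeta> UNIV \<and> (\<forall>k. distr M S (\<zeta> k) = S)"

end

theory Submission
  imports Defs
begin

text \<open>
Put \<open>P = \<phi> 1\<^sup>T\<close>, let \<open>U t = Xhat (t + 1) - X t\<close> be the compression error and \<open>L = (1 - \<gamma>) I + \<gamma> W\<close> the lazy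
mixing matrix. The iteration then reads \<open>X (t + 1) = L X t + \<gamma> (W - I) U t\<close>, a perturbed consensus
iteration with limit \<open>P X0\<close>. Two quantities have to tend to zero together: the disagreement of \<open>X t\<close> from
\<open>P X0\<close>, which is driven by the compression errors, and the lag of \<open>Xhat t\<close> behind \<open>X t\<close>, which bounds the next
compression error and is itself fed by the disagreement.

Almost everything takes place on a single sample path. The powers of \<open>L\<close> approach \<open>P\<close> at the rate
\<open>1 - \<gamma> \<delta>\<close> (\<open>lazy_mixing\<close>), so the disagreement is dominated by a scalar recursion in the norms of the
compression errors (\<open>disagreement_bound\<close>). Randomness enters in one place: the expected norm of \<open>U t\<close> is at
most \<open>1 - \<omega> / 2\<close> times that of \<open>X t - Xhat t\<close>, because the seeds at time \<open>t\<close> are independent of the state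
(\<open>fresh_compression_error_le\<close>). Working with first moments throughout keeps all other estimates plain
triangle inequalities under the expectation.

What remains is a pair of coupled linear recursions in real numbers, whose decay at the rate \<open>\<rho>\<close>
follows from a Lyapunov function (\<open>coupled_recursion_decay\<close>). Dividing by the push-sum weights, which are
at least \<open>\<kappa>\<close>, removes the bias of \<open>\<phi>\<close> (\<open>debiasing_error_le\<close>).
\<close>

section \<open>Frobenius and spectral norms\<close>

lemma bounded_bilinear_matrix_mult:
  "bounded_bilinear ((**) :: real^'m^'n \<Rightarrow> real^'k^'m \<Rightarrow> real^'k^'n)"
proof -
  have "bilinear ((**) :: real^'m^'n \<Rightarrow> real^'k^'m \<Rightarrow> real^'k^'n)"
    unfolding bilinear_def
    by (auto intro!: linearI simp: vec_eq_iff matrix_matrix_mult_def algebra_simps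
        sum.distrib sum_distrib_left)
  then show ?thesis
    by (simp add: bilinear_conv_bounded_bilinear)
qed

text \<open>
The interpretation supplies distributivity, compatibility with \<open>*\<^sub>R\<close>, and hence the continuity of
multiplication by a fixed matrix, on which the measurability of the iterates rests.
\<close>

interpretation matmul: bounded_bilinear "(**) :: real^'m^'n \<Rightarrow> real^'k^'m \<Rightarrow> real^'k^'n"
  by (rule bounded_bilinear_matrix_mult)

lemma norm_power2_columns:
  fixes A :: "real^'d^'n"
  shows "(norm A)\<^sup>2 = (\<Sum>j\<in>UNIV. (norm (column j A))\<^sup>2)"
proof -
  have "(norm A)\<^sup>2 = (\<Sum>i\<in>UNIV. \<Sum>j\<in>UNIV. (A $ i $ j)\<^sup>2)"
    by (simp add: norm_vec_def L2_set_def sum_nonneg)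
  also have "\<dots> = (\<Sum>j\<in>UNIV. \<Sum>i\<in>UNIV. (A $ i $ j)\<^sup>2)"
    by (rule sum.swap)
  also have "\<dots> = (\<Sum>j\<in>UNIV. (norm (column j A))\<^sup>2)"
    by (simp add: norm_vec_def L2_set_def sum_nonneg column_def)
  finally show ?thesis .
qed

lemma norm_power2_rows:
  fixes A :: "real^'d^'n"
  shows "(norm A)\<^sup>2 = (\<Sum>i\<in>UNIV. (norm (A $ i))\<^sup>2)"
  by (simp add: norm_vec_def[of A] L2_set_def sum_nonneg)

lemma spectral_norm_nonneg: "0 \<le> spectral_norm A"
  by (rule onorm_pos_le) simp

lemma spectral_norm_add: "spectral_norm (A + B) \<le> spectral_norm A + spectral_norm B"
  unfolding matrix_vector_mult_add_rdistrib by (rule onorm_triangle) simp_all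

lemma spectral_norm_scaleR: "spectral_norm (r *\<^sub>R A) = \<bar>r\<bar> * spectral_norm A"
  unfolding scaleR_matrix_vector_assoc[symmetric] by (rule onorm_scaleR) simp

lemma spectral_norm_diff: "spectral_norm (A - B) \<le> spectral_norm A + spectral_norm B"
  using spectral_norm_add[of A "(-1) *\<^sub>R B"] spectral_norm_scaleR[of "-1" B] by simp

text \<open>
The squared Frobenius norm is the sum of the squared column norms, and a left factor acts on each
column separately.
\<close>

lemma norm_matrix_mult_le:
  fixes A :: "real^'n^'n" and B :: "real^'d^'n"
  shows "norm (A ** B) \<le> spectral_norm A * norm B"
proof (rule power2_le_imp_le)
  have col: "column j (A ** B) = A *v column j B" for j
    by (simp add: vec_eq_iff column_def matrix_matrix_mult_def matrix_vector_mult_def)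
  have "(norm (A ** B))\<^sup>2 = (\<Sum>j\<in>UNIV. (norm (A *v column j B))\<^sup>2)"
    by (simp add: norm_power2_columns col)
  also have "\<dots> \<le> (\<Sum>j\<in>UNIV. (spectral_norm A * norm (column j B))\<^sup>2)"
    by (intro sum_mono power_mono onorm) simp_all
  also have "\<dots> = (spectral_norm A * norm B)\<^sup>2"
    by (simp add: power_mult_distrib norm_power2_columns[of B] sum_distrib_left)
  finally show "(norm (A ** B))\<^sup>2 \<le> (spectral_norm A * norm B)\<^sup>2" .
qed (simp add: spectral_norm_nonneg)

lemma matrix_power_Suc_right: "matrix_power A (Suc t) = matrix_power A t ** A"
  by (induction t) (simp_all add: matrix_mul_assoc)

text \<open>
By Cauchy-Schwarz, repeating the mean of the rows in every row does not increase the Frobenius norm.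
\<close>

lemma norm_row_average_le:
  fixes A :: "real^'d^'n::finite"
  shows "norm ((1 / real CARD('n)) *\<^sub>R
    ((columnvector (1 :: real^'n) ** (rowvector 1 :: real^'n^1)) ** A)) \<le> norm A"
    (is "norm ?B \<le> _")
proof (rule power2_le_imp_le)
  let ?n = "real CARD('n)" and ?s = "\<Sum>i\<in>UNIV. norm (A $ i)"
  have row: "?B $ i = (1 / ?n) *\<^sub>R (\<Sum>k\<in>UNIV. A $ k)" for i
    by (simp add: vec_eq_iff matrix_matrix_mult_def columnvector_def rowvector_def UNIV_1)
  have s: "?s\<^sup>2 \<le> ?n * (norm A)\<^sup>2"
    using sum_squared_le_sum_of_squares[of "\<lambda>i. norm (A $ i)" UNIV]
    by (simp add: norm_power2_rows mult.commute)
  have "norm (?B $ i) \<le> ?s / ?n" for i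
    using norm_sum[of "\<lambda>k. A $ k" UNIV] unfolding row by (simp add: divide_right_mono)
  then have "(norm ?B)\<^sup>2 \<le> (\<Sum>i\<in>(UNIV :: 'n set). (?s / ?n)\<^sup>2)"
    unfolding norm_power2_rows[of ?B] by (intro sum_mono power_mono) auto
  also have "\<dots> = ?s\<^sup>2 / ?n"
    by (simp add: power2_eq_square)
  also have "\<dots> \<le> (norm A)\<^sup>2"
    using s by (simp add: pos_divide_le_eq mult.commute)
  finally show "(norm ?B)\<^sup>2 \<le> (norm A)\<^sup>2" .
qed simp

section \<open>Perturbed consensus on a sample path\<close>

text \<open>
The lazy matrix \<open>(1 - \<gamma>) I + \<gamma> W\<close> inherits the mixing of \<open>W\<close> at the rate \<open>1 - \<gamma> \<delta>\<close>, which is the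
average of the rates \<open>1\<close> of \<open>I\<close> and \<open>1 - \<delta>\<close> of \<open>W\<close>. Bounding all products \<open>L\<^sup>k W\<^sup>j\<close> at once makes the
induction go through, since \<open>L\<^sup>k\<^sup>+\<^sup>1 W\<^sup>j\<close> is the convex combination of \<open>L\<^sup>k W\<^sup>j\<close> and \<open>L\<^sup>k W\<^sup>j\<^sup>+\<^sup>1\<close>
with the weights \<open>1 - \<gamma>\<close> and \<open>\<gamma>\<close>.
\<close>

lemma lazy_mixing:
  fixes W P :: "real^'n^'n"
  assumes mixing: "\<And>j. spectral_norm (matrix_power W j - P) \<le> C * (1 - \<delta>) ^ j"
    and g: "0 \<le> \<gamma>" "\<gamma> \<le> 1"
  defines "L \<equiv> mat 1 + \<gamma> *\<^sub>R (W - mat 1)"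
  shows "spectral_norm (matrix_power L k - P) \<le> C * (1 - \<gamma> * \<delta>) ^ k"
proof -
  have "spectral_norm (matrix_power L k ** matrix_power W j - P)
      \<le> C * (1 - \<gamma> * \<delta>) ^ k * (1 - \<delta>) ^ j" for j
  proof (induction k arbitrary: j)
    case 0
    then show ?case using mixing[of j] by simp
  next
    case (Suc k)
    let ?A = "\<lambda>j. matrix_power L k ** matrix_power W j - P"
    have "L ** matrix_power W j = (1 - \<gamma>) *\<^sub>R matrix_power W j + \<gamma> *\<^sub>R matrix_power W (Suc j)"
      unfolding L_def by (simp add: matmul.add_left matmul.diff_left matmul.scaleR_left algebra_simps)
    then have "matrix_power L (Suc k) ** matrix_power W j - P = (1 - \<gamma>) *\<^sub>R ?A j + \<gamma> *\<^sub>R ?A (Suc j)"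
      by (simp only: matrix_power_Suc_right matrix_mul_assoc[symmetric])
         (simp add: matmul.add_right matmul.diff_right matmul.scaleR_right scaleR_left_diff_distrib
            scaleR_right_diff_distrib del: matrix_power.simps)
    then have "spectral_norm (matrix_power L (Suc k) ** matrix_power W j - P)
        \<le> spectral_norm ((1 - \<gamma>) *\<^sub>R ?A j) + spectral_norm (\<gamma> *\<^sub>R ?A (Suc j))"
      by (simp only: spectral_norm_add)
    also have "\<dots> = (1 - \<gamma>) * spectral_norm (?A j) + \<gamma> * spectral_norm (?A (Suc j))"
      using g by (simp add: spectral_norm_scaleR del: matrix_power.simps)
    also have "\<dots> \<le> (1 - \<gamma>) * (C * (1 - \<gamma> * \<delta>) ^ k * (1 - \<delta>) ^ j)
        + \<gamma> * (C * (1 - \<gamma> * \<delta>) ^ k * (1 - \<delta>) ^ Suc j)"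
      using g by (intro add_mono mult_left_mono Suc.IH) auto
    also have "\<dots> = C * (1 - \<gamma> * \<delta>) ^ Suc k * (1 - \<delta>) ^ j"
      by (simp add: algebra_simps)
    finally show ?case .
  qed
  from this[of 0] show ?thesis by simp
qed

text \<open>
The mixing bounds at times \<open>0\<close> and \<open>1\<close> compare \<open>I\<close> and \<open>W\<close> with the same matrix \<open>P\<close>. This ties the size of
\<open>W - I\<close> to the constant \<open>C\<close>, which the final constant of the rate relies on.
\<close>

lemma spectral_norm_diff_mat_1_le:
  fixes W P :: "real^'n^'n"
  assumes mixing: "\<And>j. spectral_norm (matrix_power W j - P) \<le> C * (1 - \<delta>) ^ j"
    and "0 \<le> \<delta>" "0 \<le> C"
  shows "spectral_norm (W - mat 1) \<le> 2 * C"
proof -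
  have "spectral_norm (W - mat 1) = spectral_norm ((matrix_power W 1 - P) - (matrix_power W 0 - P))"
    by simp
  also have "\<dots> \<le> C * (1 - \<delta>) ^ 1 + C * (1 - \<delta>) ^ 0"
    by (rule order.trans[OF spectral_norm_diff add_mono[OF mixing mixing]])
  also have "\<dots> \<le> 2 * C"
    using assms(2,3) by (simp add: algebra_simps)
  finally show ?thesis .
qed

text \<open>
Here \<open>U t\<close> is the compression error, so that agents mix \<open>A t + U t\<close> instead of \<open>A t\<close>. The deviation from
the limit \<open>P ** A 0\<close> evolves under the lazy matrix \<open>L\<close> with the additional input
\<open>\<gamma> *\<^sub>R ((W - mat 1) ** U t)\<close>. Since a single step of \<open>L\<close> need not contract, the induction
controls the whole future \<open>L\<^sup>k\<close> of the deviation. The input is annihilated by \<open>P\<close>, so \<open>L\<^sup>k\<close> acts on it as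
\<open>L\<^sup>k - P\<close> and each input costs the factor \<open>C\<close> just once.
\<close>

lemma disagreement_bound:
  fixes W P :: "real^'n^'n" and A U :: "nat \<Rightarrow> real^'d^'n" and R :: "nat \<Rightarrow> real"
  assumes mixing: "\<And>j. spectral_norm (matrix_power W j - P) \<le> C * (1 - \<delta>) ^ j"
    and WP: "W ** P = P" and PW: "P ** W = P"
    and g: "0 \<le> \<gamma>" "\<gamma> \<le> 1"
    and A_step: "\<And>t. A (Suc t) = A t + \<gamma> *\<^sub>R ((W - mat 1) ** (A t + U t))"
    and R_0: "R 0 = C * norm (A 0)"
    and R_step: "\<And>t. R (Suc t)
      = (1 - \<gamma> * \<delta>) * R t + \<gamma> * spectral_norm (W - mat 1) * C * norm (U t)"
  shows "norm (A t - P ** A 0) \<le> R t"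
proof -
  define L where "L = mat 1 + \<gamma> *\<^sub>R (W - mat 1)"
  have lazy: "spectral_norm (matrix_power L k - P) \<le> C * (1 - \<gamma> * \<delta>) ^ k" for k
    unfolding L_def by (rule lazy_mixing[OF mixing g])
  have LP: "L ** P = P"
    by (simp add: L_def matmul.add_left matmul.scaleR_left matmul.diff_left WP)
  have LkP: "matrix_power L k ** P = P" for k
    by (induction k) (simp_all add: LP flip: matrix_mul_assoc)
  have P0: "P ** (W - mat 1) = 0"
    by (simp add: matmul.diff_right PW)
  have "norm (matrix_power L k ** (A t - P ** A 0)) \<le> (1 - \<gamma> * \<delta>) ^ k * R t" for k
  proof (induction t arbitrary: k)
    case 0
    have "norm (matrix_power L k ** (A 0 - P ** A 0)) = norm ((matrix_power L k - P) ** A 0)"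
      by (simp add: matmul.diff_right matmul.diff_left matrix_mul_assoc LkP)
    also have "\<dots> \<le> C * (1 - \<gamma> * \<delta>) ^ k * norm (A 0)"
      by (rule order.trans[OF norm_matrix_mult_le mult_right_mono[OF lazy]]) simp
    finally show ?case by (simp add: R_0 mult_ac)
  next
    case (Suc t)
    let ?b = "spectral_norm (W - mat 1)"
    have 1: "A (Suc t) - P ** A 0 = L ** (A t - P ** A 0) + \<gamma> *\<^sub>R ((W - mat 1) ** U t)"
    proof -
      have "L ** (A t - P ** A 0) = L ** A t - P ** A 0"
        by (simp add: matmul.diff_right matrix_mul_assoc LP)
      then show ?thesis
        by (simp add: A_step matmul.add_right scaleR_add_right)
           (simp add: L_def matmul.add_left matmul.scaleR_left)
    qed
    have 2: "matrix_power L k ** ((W - mat 1) ** U t)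
        = (matrix_power L k - P) ** ((W - mat 1) ** U t)"
      by (simp add: matmul.diff_left[of "matrix_power L k"] matrix_mul_assoc[of P] P0)
    have "matrix_power L k ** (A (Suc t) - P ** A 0) = matrix_power L (Suc k) ** (A t - P ** A 0)
        + \<gamma> *\<^sub>R ((matrix_power L k - P) ** ((W - mat 1) ** U t))"
      unfolding 1
      by (simp only: matmul.add_right matmul.scaleR_right 2 matrix_power_Suc_right)
         (simp only: matrix_mul_assoc)
    then have "norm (matrix_power L k ** (A (Suc t) - P ** A 0))
      \<le> norm (matrix_power L (Suc k) ** (A t - P ** A 0))
        + \<gamma> * norm ((matrix_power L k - P) ** ((W - mat 1) ** U t))"
      using g(1) by (metis norm_triangle_ineq norm_scaleR abs_of_nonneg)
    also have "\<dots> \<le> (1 - \<gamma> * \<delta>) ^ Suc k * R t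
        + \<gamma> * ((C * (1 - \<gamma> * \<delta>) ^ k) * (?b * norm (U t)))"
      using g(1)
      by (intro add_mono Suc.IH mult_left_mono
          order.trans[OF norm_matrix_mult_le mult_mono[OF lazy norm_matrix_mult_le]]
          order.trans[OF spectral_norm_nonneg lazy]) auto
    also have "\<dots> = (1 - \<gamma> * \<delta>) ^ k * R (Suc t)"
      by (simp add: R_step algebra_simps)
    finally show ?case .
  qed
  from this[of 0] show ?thesis by simp
qed

section \<open>Decay of the coupled recursions\<close>

text \<open>
The compression lag \<open>e\<close> and the disagreement \<open>R\<close> feed each other; the weighted sum \<open>V = e + a R\<close> decays at
the rate \<open>\<rho> = 1 - \<gamma> \<delta> \<omega> / 4\<close>. The weight \<open>a = \<beta> / (\<delta> (1 - \<omega> / 4))\<close> is the one for which the coefficient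
of \<open>R\<close> in the bound for the next \<open>V\<close> is exactly \<open>\<rho> a\<close>, and \<open>\<gamma>\<close> is small enough for the coefficient of \<open>e\<close> to be at most
\<open>\<rho>\<close>.

The decay of \<open>V\<close> alone bounds \<open>R\<close> by \<open>V / a\<close>, which is too weak when \<open>\<beta>\<close> is small compared with \<open>\<delta>\<close>. In that
case the bound for \<open>e\<close> is inserted into the recursion for \<open>R\<close>, where it is damped by the factor \<open>\<beta>\<close>. In the
opposite case that argument would cost a factor \<open>1 / \<delta>\<^sup>2\<close>, whereas \<open>V / a\<close> is good enough because \<open>\<beta> \<le> 2 C\<close>.
\<close>

lemma coupled_recursion_decay:
  fixes \<omega> \<delta> \<beta> C N :: real and e R :: "nat \<Rightarrow> real"
  assumes \<omega>: "0 < \<omega>" "\<omega> \<le> 1" and \<delta>: "0 < \<delta>" "\<delta> \<le> 1"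
    and \<beta>: "0 \<le> \<beta>" "\<beta> \<le> 2 * C" and C: "0 < C" and N: "0 \<le> N"
    and \<gamma>: "\<gamma> = 2 * \<omega> * \<delta> / (8 * \<beta> * \<delta> + 4 * \<beta>\<^sup>2 * C + 4 * \<omega> * \<delta>\<^sup>2)"
    and \<rho>: "\<rho> = 1 - \<omega>\<^sup>2 * \<delta>\<^sup>2 / (16 * \<beta> * \<delta> + 8 * \<beta>\<^sup>2 * C + 8 * \<omega> * \<delta>\<^sup>2)"
    and e_nonneg: "\<And>t. 0 \<le> e t" and R_nonneg: "\<And>t. 0 \<le> R t"
    and e_0: "e 0 = N" and R_0: "R 0 = C * N"
    and e_step: "\<And>t. e (Suc t) \<le> (1 + \<gamma> * \<beta>) * (1 - \<omega> / 2) * e t + \<gamma> * \<beta> * R t"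
    and R_step: "\<And>t. R (Suc t) \<le> (1 - \<gamma> * \<delta>) * R t + \<gamma> * \<beta> * C * (1 - \<omega> / 2) * e t"
    and g1: "\<gamma> \<le> 1"
  shows "R t + C * (1 - \<delta>) ^ t * N \<le> 4 * C * (1 + \<beta> * C) * N / \<delta> * \<rho> ^ t"
proof -
  define D where "D = 4 * \<beta> * \<delta> + 2 * \<beta>\<^sup>2 * C + 2 * \<omega> * \<delta>\<^sup>2"
  define c where "c = 1 - \<omega> / 4"
  define a where "a = \<beta> / (\<delta> * c)"
  have D: "D > 0"
    using \<omega> \<delta> \<beta> C unfolding D_def by (intro add_nonneg_pos) auto
  have c: "3 / 4 \<le> c" "c < 1"
    using \<omega> by (simp_all add: c_def)
  have a0: "0 \<le> a"
    using \<beta> \<delta> c by (simp add: a_def)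
  have \<gamma>': "\<gamma> = \<omega> * \<delta> / D"
  proof -
    have "\<gamma> = (2 * (\<omega> * \<delta>)) / (2 * D)"
      unfolding \<gamma> D_def by (simp add: algebra_simps)
    then show ?thesis by simp
  qed
  have g0: "0 < \<gamma>"
    using \<omega> \<delta> D by (simp add: \<gamma>')
  have \<rho>': "\<rho> = 1 - \<gamma> * \<delta> * \<omega> / 4"
  proof -
    have "\<omega>\<^sup>2 * \<delta>\<^sup>2 / (16 * \<beta> * \<delta> + 8 * \<beta>\<^sup>2 * C + 8 * \<omega> * \<delta>\<^sup>2) = \<omega>\<^sup>2 * \<delta>\<^sup>2 / (4 * D)"
      by (rule arg_cong2[where f = "(/)"]) (simp_all add: D_def)
    also have "\<dots> = \<gamma> * \<delta> * \<omega> / 4"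
      by (simp add: \<gamma>' power2_eq_square mult_ac)
    finally show ?thesis by (simp add: \<rho>)
  qed
  have gd: "\<gamma> * \<delta> \<le> \<delta>" "0 < \<gamma> * \<delta>"
    using g0 g1 \<delta> by (simp_all add: mult_left_le_one_le)
  have gdw: "\<gamma> * \<delta> * \<omega> \<le> \<gamma> * \<delta>"
    using mult_left_mono[of \<omega> 1 "\<gamma> * \<delta>"] gd \<omega> by simp
  have \<rho>\<delta>: "1 - \<delta> \<le> \<rho>" and \<rho>_nonneg: "0 \<le> \<rho>"
    using gd gdw \<delta> unfolding \<rho>' by linarith+
  have ac: "a * \<delta> * c = \<beta>"
    using \<delta> c by (simp add: a_def)
  have coeff_e: "(1 + \<gamma> * \<beta>) * (1 - \<omega> / 2) + a * (\<gamma> * \<beta> * C * (1 - \<omega> / 2)) \<le> \<rho>"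
  proof -
    \<comment> \<open>\<open>\<theta>\<close> is the share of \<open>2 \<omega> \<delta>\<^sup>2\<close> in the denominator \<open>D\<close> of \<open>\<gamma>\<close>. The rest of \<open>D\<close> absorbs the feedback
        terms, and the resulting inequality is affine in \<open>\<theta>\<close> on the interval from 0 to 1.\<close>
    define \<theta> where "\<theta> = 2 * \<gamma> * \<delta>"
    have \<theta>: "\<theta> = 2 * \<omega> * \<delta>\<^sup>2 / D" by (simp add: \<theta>_def \<gamma>' power2_eq_square)
    have th: "0 \<le> \<theta>" "\<theta> \<le> 1"
      using \<omega> \<delta> D \<beta> C by (auto simp: \<theta> D_def)
    have "\<gamma> * D = \<omega> * \<delta>" using D by (simp add: \<gamma>')
    moreover have "\<delta> * (\<gamma> * (4 * \<beta> + 2 * (\<beta>\<^sup>2 * C / \<delta>))) = \<gamma> * D - 2 * \<gamma> * \<omega> * \<delta>\<^sup>2"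
      using \<delta> by (simp add: D_def algebra_simps)
    ultimately have "\<delta> * (\<gamma> * (4 * \<beta> + 2 * (\<beta>\<^sup>2 * C / \<delta>))) = \<delta> * (\<omega> * (1 - \<theta>))"
      by (simp add: \<theta>_def algebra_simps power2_eq_square)
    then have *: "\<gamma> * (4 * \<beta> + 2 * (\<beta>\<^sup>2 * C / \<delta>)) = \<omega> * (1 - \<theta>)"
      using \<delta> by simp
    have "c * (\<gamma> * \<beta> + a * (\<gamma> * \<beta> * C)) = \<gamma> * (c * \<beta> + \<beta>\<^sup>2 * C / \<delta>)"
      using \<delta> c by (simp add: a_def power2_eq_square field_simps)
    also have "\<dots> \<le> \<gamma> * (2 * \<beta> + \<beta>\<^sup>2 * C / \<delta>)"
      using g0 \<beta> c by (intro mult_left_mono add_right_mono mult_right_mono) auto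
    also have "\<dots> = \<omega> * (1 - \<theta>) / 2"
      using * by (simp add: algebra_simps)
    finally have 1: "c * (\<gamma> * \<beta> + a * (\<gamma> * \<beta> * C)) \<le> \<omega> * (1 - \<theta>) / 2" .
    have "c * ((1 + \<gamma> * \<beta>) * (1 - \<omega> / 2) + a * (\<gamma> * \<beta> * C * (1 - \<omega> / 2)))
      = (1 - \<omega> / 2) * (c + c * (\<gamma> * \<beta> + a * (\<gamma> * \<beta> * C)))"
      by (simp add: algebra_simps)
    also have "\<dots> \<le> (1 - \<omega> / 2) * (c + \<omega> * (1 - \<theta>) / 2)"
      using \<omega> 1 by (intro mult_left_mono add_left_mono) auto
    also have "\<dots> \<le> c * \<rho>"
    proof -
      have "c * \<rho> - (1 - \<omega> / 2) * (c + \<omega> * (1 - \<theta>) / 2)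
        = (1 - \<theta>) * (\<omega>\<^sup>2 / 8) + \<theta> * (c * (3 * \<omega> / 8))"
        unfolding \<rho>' c_def \<theta>_def by (simp add: field_simps power2_eq_square)
      also have "\<dots> \<ge> 0"
        using th c \<omega> by (intro add_nonneg_nonneg mult_nonneg_nonneg) auto
      finally show ?thesis by simp
    qed
    finally show ?thesis
      using c by simp
  qed
  have coeff_R: "\<gamma> * \<beta> + a * (1 - \<gamma> * \<delta>) = \<rho> * a"
  proof -
    have "\<gamma> * \<beta> = \<gamma> * \<delta> * c * a" using ac by (simp add: mult_ac)
    then show ?thesis unfolding \<rho>' c_def by (simp add: algebra_simps)
  qed
  define V where "V = (\<lambda>t. e t + a * R t)"
  have V_step: "V (Suc t) \<le> \<rho> * V t" for t
  proof -
    have "V (Suc t) \<le> ((1 + \<gamma> * \<beta>) * (1 - \<omega> / 2) * e t + \<gamma> * \<beta> * R t)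
        + a * ((1 - \<gamma> * \<delta>) * R t + \<gamma> * \<beta> * C * (1 - \<omega> / 2) * e t)"
      unfolding V_def using a0 by (intro add_mono e_step mult_left_mono R_step)
    also have "\<dots> = ((1 + \<gamma> * \<beta>) * (1 - \<omega> / 2) + a * (\<gamma> * \<beta> * C * (1 - \<omega> / 2))) * e t
        + (\<gamma> * \<beta> + a * (1 - \<gamma> * \<delta>)) * R t"
      by (simp add: algebra_simps)
    also have "\<dots> \<le> \<rho> * e t + \<rho> * a * R t"
      unfolding coeff_R using e_nonneg by (intro add_right_mono mult_right_mono coeff_e)
    finally show ?thesis by (simp add: V_def algebra_simps)
  qed
  have V_le: "V t \<le> V 0 * \<rho> ^ t" for t
  proof (induction t)
    case (Suc t)
    then show ?case
      using V_step[of t] mult_left_mono[OF Suc.IH \<rho>_nonneg] by (simp add: mult_ac)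
  qed simp
  have V_0: "V 0 = N * (1 + a * C)"
    by (simp add: V_def e_0 R_0 algebra_simps)
  have \<delta>_pow: "C * (1 - \<delta>) ^ t * N \<le> C * N * \<rho> ^ t"
    using power_mono[OF \<rho>\<delta>, of t] \<delta> C N
    by (simp add: mult_ac mult_left_mono)
  \<comment> \<open>The additional term \<open>C * N\<close> leaves room for the second summand of the claim, which decays at least as
      fast as \<open>\<rho> ^ t\<close>.\<close>
  have R_bound: "\<exists>K. R t \<le> K * \<rho> ^ t \<and> K + C * N \<le> 4 * C * (1 + \<beta> * C) * N / \<delta>"
  proof (cases "\<delta> \<le> \<beta>")
    case True
    then have \<beta>0: "\<beta> > 0" using \<delta> by linarith
    then have a: "a > 0" using \<delta> c by (simp add: a_def)
    have "a * R t \<le> V 0 * \<rho> ^ t"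
      using V_le[of t] e_nonneg[of t] by (simp add: V_def)
    then have "R t \<le> V 0 / a * \<rho> ^ t"
      using a by (simp add: field_simps)
    moreover have "V 0 / a + C * N \<le> 4 * C * (1 + \<beta> * C) * N / \<delta>"
    proof -
      have "1 / a = \<delta> * c / \<beta>" by (simp add: a_def)
      also have "\<dots> \<le> \<delta> / \<beta>"
        using \<beta>0 \<delta> c by (intro divide_right_mono) (auto simp: mult_le_cancel_left1)
      also have "\<dots> \<le> 2 * C / \<delta>"
      proof -
        have "\<delta> * \<delta> \<le> \<beta> * (2 * C)" using True \<beta> \<delta> by (intro mult_mono) auto
        then show ?thesis using \<beta>0 \<delta> by (simp add: field_simps)
      qed
      finally have 1: "1 / a \<le> 2 * C / \<delta>" .
      have "C * \<delta> \<le> C" using C \<delta> by simp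
      then have 2: "C \<le> C / \<delta>" using \<delta> by (simp add: field_simps)
      have 3: "0 \<le> 4 * C * (\<beta> * C) / \<delta>"
        using C \<beta> \<delta> by simp
      have "4 * C * (1 + \<beta> * C) / \<delta> = 4 * (C / \<delta>) + 4 * C * (\<beta> * C) / \<delta>"
        by (simp add: algebra_simps add_divide_distrib)
      with 1 2 3 have "1 / a + C + C \<le> 4 * C * (1 + \<beta> * C) / \<delta>" by simp
      from mult_right_mono[OF this N] show ?thesis
        using a unfolding V_0 by (simp add: field_simps)
    qed
    ultimately show ?thesis by blast
  next
    case False
    define K where "K = C * N + \<beta> * C / \<delta> * V 0"
    have V0: "0 \<le> V 0" using N a0 C by (simp add: V_0)
    have "R t \<le> K * \<rho> ^ t"
    proof (induction t)
      case 0
      show ?case using \<beta> C \<delta> V0 by (simp add: R_0 K_def)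
    next
      case (Suc t)
      have "e t \<le> V t"
        using R_nonneg[of t] a0 by (simp add: V_def)
      also have "\<dots> \<le> V 0 * \<rho> ^ t"
        by (rule V_le)
      finally have e: "e t \<le> V 0 * \<rho> ^ t" .
      have K: "0 \<le> K" "\<beta> * C * V 0 \<le> \<delta> * K"
        using \<beta> C \<delta> V0 N by (simp_all add: K_def algebra_simps)
      have "R (Suc t) \<le> (1 - \<gamma> * \<delta>) * (K * \<rho> ^ t) + \<gamma> * \<beta> * C * (1 - \<omega> / 2) * (V 0 * \<rho> ^ t)"
        using order.trans[OF gd(1) \<delta>(2)] g0 \<beta> C \<omega>
        by (intro order.trans[OF R_step] add_mono mult_left_mono Suc.IH e mult_nonneg_nonneg) auto
      also have "\<dots> = ((1 - \<gamma> * \<delta>) * K + \<gamma> * ((1 - \<omega> / 2) * (\<beta> * C * V 0))) * \<rho> ^ t"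
        by (simp add: algebra_simps)
      also have "\<dots> \<le> ((1 - \<gamma> * \<delta>) * K + \<gamma> * (c * (\<delta> * K))) * \<rho> ^ t"
      proof -
        have "(1 - \<omega> / 2) * (\<beta> * C * V 0) \<le> c * (\<delta> * K)"
          using \<omega> \<beta> C V0 c by (intro mult_mono[OF _ K(2)]) (auto simp: c_def)
        then show ?thesis
          using g0 \<rho>_nonneg by (intro mult_right_mono add_left_mono mult_left_mono) auto
      qed
      also have "\<dots> = K * \<rho> ^ Suc t"
        unfolding \<rho>' c_def by (simp add: algebra_simps)
      finally show ?case .
    qed
    moreover have "K + C * N \<le> 4 * C * (1 + \<beta> * C) * N / \<delta>"
    proof -
      have r: "0 \<le> \<beta> / \<delta>" "\<beta> / \<delta> \<le> 1"
        using False \<beta> \<delta> by simp_all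
      have "a = (\<beta> / \<delta>) * (1 / c)"
        by (simp add: a_def)
      also have "\<dots> \<le> 1 * (4 / 3)"
        using r c by (intro mult_mono) (auto simp: field_simps)
      finally have "\<beta> / \<delta> * (1 + a * C) \<le> \<beta> / \<delta> * (1 + 4 / 3 * C)"
        using r C by (intro mult_left_mono add_left_mono mult_right_mono) auto
      also have "\<dots> = \<beta> / \<delta> + 4 / 3 * (\<beta> * C / \<delta>)"
        by (simp add: algebra_simps)
      also have "\<dots> \<le> 1 + 4 * (\<beta> * C / \<delta>)"
        using r \<beta> C \<delta> by (intro add_mono mult_right_mono) auto
      finally have "2 + \<beta> / \<delta> * (1 + a * C) \<le> 3 / \<delta> + 4 * (\<beta> * C / \<delta>)"
      proof -
        assume *: "\<beta> / \<delta> * (1 + a * C) \<le> 1 + 4 * (\<beta> * C / \<delta>)"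
        have "3 \<le> 3 / \<delta>" using \<delta> by (simp add: field_simps)
        with * show ?thesis by linarith
      qed
      also have "\<dots> \<le> 4 * (1 + \<beta> * C) / \<delta>"
        using \<delta> by (simp add: field_simps)
      finally have "C * N * (2 + \<beta> / \<delta> * (1 + a * C)) \<le> C * N * (4 * (1 + \<beta> * C) / \<delta>)"
        using C N by (intro mult_left_mono) auto
      then show ?thesis
        unfolding K_def V_0 by (simp add: algebra_simps)
    qed
    ultimately show ?thesis by blast
  qed
  then obtain K where K: "R t \<le> K * \<rho> ^ t" "K + C * N \<le> 4 * C * (1 + \<beta> * C) * N / \<delta>"
    by blast
  have "R t + C * (1 - \<delta>) ^ t * N \<le> (K + C * N) * \<rho> ^ t"
    using K(1) \<delta>_pow by (simp add: algebra_simps)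
  also have "\<dots> \<le> 4 * C * (1 + \<beta> * C) * N / \<delta> * \<rho> ^ t"
    by (rule mult_right_mono[OF K(2)]) (simp add: \<rho>_nonneg)
  finally show ?thesis .
qed

section \<open>Compression with fresh randomness\<close>

context prob_space begin

text \<open>
A bound for every frozen value of \<open>D\<close> may be averaged over \<open>D\<close> when \<open>Y\<close> is independent of \<open>D\<close>: the joint law
is a product measure, and Tonelli applies. This takes the place of conditioning on the past.
\<close>

lemma indep_var_nn_integral_le:
  assumes indep: "indep_var N1 D N2 Y"
    and g: "case_prod g \<in> borel_measurable (N1 \<Otimes>\<^sub>M N2)"
    and le: "\<And>d. d \<in> space N1 \<Longrightarrow> (\<integral>\<^sup>+ a. g d (Y a) \<partial>M) \<le> h d"
  shows "(\<integral>\<^sup>+ a. g (D a) (Y a) \<partial>M) \<le> (\<integral>\<^sup>+ a. h (D a) \<partial>M)"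
proof -
  have D: "D \<in> M \<rightarrow>\<^sub>M N1" and Y: "Y \<in> M \<rightarrow>\<^sub>M N2"
    and joint: "distr M N1 D \<Otimes>\<^sub>M distr M N2 Y = distr M (N1 \<Otimes>\<^sub>M N2) (\<lambda>a. (D a, Y a))"
    using indep unfolding indep_var_distribution_eq by auto
  interpret Y: prob_space "distr M N2 Y" by (rule prob_space_distr[OF Y])
  have g': "case_prod g \<in> borel_measurable (N1 \<Otimes>\<^sub>M distr M N2 Y)"
    using g by (simp cong: measurable_cong_sets sets_pair_measure_cong)
  have "(\<integral>\<^sup>+ a. g (D a) (Y a) \<partial>M)
      = (\<integral>\<^sup>+ z. case_prod g z \<partial>distr M (N1 \<Otimes>\<^sub>M N2) (\<lambda>a. (D a, Y a)))"
    using D Y g by (subst nn_integral_distr) auto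
  also have "\<dots> = (\<integral>\<^sup>+ d. \<integral>\<^sup>+ b. g d b \<partial>distr M N2 Y \<partial>distr M N1 D)"
    unfolding joint[symmetric]
    using g by (subst Y.nn_integral_fst[symmetric])
      (simp_all cong: measurable_cong_sets sets_pair_measure_cong)
  also have "\<dots> = (\<integral>\<^sup>+ a. \<integral>\<^sup>+ b. g (D a) b \<partial>distr M N2 Y \<partial>M)"
    using Y.borel_measurable_nn_integral[OF g'] by (intro nn_integral_distr[OF D]) simp
  also have "\<dots> \<le> (\<integral>\<^sup>+ a. h (D a) \<partial>M)"
  proof (rule nn_integral_mono)
    fix a assume "a \<in> space M"
    then have d: "D a \<in> space N1" by (rule measurable_space[OF D])
    have "(\<integral>\<^sup>+ b. g (D a) b \<partial>distr M N2 Y) = (\<integral>\<^sup>+ b. g (D a) (Y b) \<partial>M)"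
      using measurable_compose_Pair1[OF d g] by (intro nn_integral_distr[OF Y]) simp
    then show "(\<integral>\<^sup>+ b. g (D a) b \<partial>distr M N2 Y) \<le> h (D a)"
      using le[OF d] by simp
  qed
  finally show ?thesis .
qed

lemma expectation_le_sqrt_second_moment:
  fixes f :: "'a \<Rightarrow> real"
  assumes "f \<in> borel_measurable M" "integrable M (\<lambda>a. (f a)\<^sup>2)"
  shows "integrable M f" "expectation f \<le> sqrt (expectation (\<lambda>a. (f a)\<^sup>2))"
proof -
  show f: "integrable M f"
    using assms by (rule square_integrable_imp_integrable)
  have "0 \<le> variance f" by simp
  then have "(expectation f)\<^sup>2 \<le> expectation (\<lambda>a. (f a)\<^sup>2)"
    by (simp add: variance_eq[OF f assms(2)])
  then show "expectation f \<le> sqrt (expectation (\<lambda>a. (f a)\<^sup>2))"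
    by (rule real_le_rsqrt)
qed

end

text \<open>
The vector is a finite sum of continuous images of its entries, which are themselves vectors here.
\<close>

lemma borel_measurable_vec_lambda:
  fixes f :: "'a \<Rightarrow> 'n::finite \<Rightarrow> real^'d"
  assumes "\<And>i. (\<lambda>x. f x i) \<in> borel_measurable N"
  shows "(\<lambda>x. \<chi> i. f x i) \<in> borel_measurable N"
proof -
  have "(\<chi> i. f x i) = (\<Sum>i\<in>UNIV. axis i (f x i))" for x
    by (simp add: vec_eq_iff axis_def)
  moreover have "(\<lambda>v :: real^'d. axis (i :: 'n) v) \<in> borel_measurable borel" for i
  proof (intro borel_measurable_continuous_onI)
    have "continuous_on UNIV (\<lambda>v :: real^'d. if j = i then v else 0)" for j :: 'n
      by (cases "j = i") simp_all
    then show "continuous_on UNIV (\<lambda>v :: real^'d. axis i v)"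
      unfolding axis_def by (intro continuous_on_vec_lambda)
  qed
  ultimately show ?thesis
    using assms by (auto intro!: borel_measurable_sum intro: measurable_compose)
qed

lemma borel_measurable_compress_rows:
  assumes Q: "(\<lambda>(x, s). Q x s) \<in> borel \<Otimes>\<^sub>M S \<rightarrow>\<^sub>M borel"
    and f: "f \<in> borel_measurable N" and s: "\<And>i. (\<lambda>x. s x i) \<in> N \<rightarrow>\<^sub>M S"
  shows "(\<lambda>x. compress_rows Q (f x) (s x) :: real^'d^'n) \<in> borel_measurable N"
  unfolding compress_rows_def
proof (rule borel_measurable_vec_lambda)
  fix i
  have "(\<lambda>A :: real^'d^'n. A $ i) \<in> borel_measurable borel"
    by (intro borel_measurable_continuous_onI continuous_intros)
  from measurable_compose[OF f this] have "(\<lambda>x. (f x $ i, s x i)) \<in> N \<rightarrow>\<^sub>M borel \<Otimes>\<^sub>M S"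
    using s by (intro measurable_Pair) auto
  from measurable_compose[OF this Q] show "(\<lambda>x. Q (f x $ i) (s x i)) \<in> borel_measurable N"
    by simp
qed

context prob_space begin

text \<open>
The second moments of the row errors add up to that of the Frobenius norm of the error. Jensen's
inequality and \<open>1 - \<omega> \<le> (1 - \<omega> / 2)\<^sup>2\<close> turn the bound into one for the first moment, and first moments
can be propagated by the triangle inequality alone.
\<close>

lemma compression_error_le:
  fixes A :: "real^'d^'n::finite"
  assumes Q: "randomized_compressor \<omega> S Q" and \<omega>: "\<omega> \<le> 1"
    and Y: "\<And>i. Y i \<in> M \<rightarrow>\<^sub>M S" and law: "\<And>i. distr M S (Y i) = S"
  shows "(\<integral>\<^sup>+ a. ennreal (norm (compress_rows Q A (\<lambda>i. Y i a) - A)) \<partial>M)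
    \<le> ennreal ((1 - \<omega> / 2) * norm A)"
proof -
  let ?E = "\<lambda>a. compress_rows Q A (\<lambda>i. Y i a) - A"
  have Q_meas: "(\<lambda>(x, s). Q x s) \<in> borel \<Otimes>\<^sub>M S \<rightarrow>\<^sub>M borel"
    and Q_int: "\<And>x. integrable S (\<lambda>s. (norm (Q x s - x))\<^sup>2)"
    and Q_le: "\<And>x. (\<integral>s. (norm (Q x s - x))\<^sup>2 \<partial>S) \<le> (1 - \<omega>) * (norm x)\<^sup>2"
    using Q unfolding randomized_compressor_def by auto
  have E_meas: "?E \<in> borel_measurable M"
    by (intro borel_measurable_diff borel_measurable_compress_rows[OF Q_meas] Y) auto
  have E_sq: "(norm (?E a))\<^sup>2 = (\<Sum>i\<in>UNIV. (norm (Q (A $ i) (Y i a) - A $ i))\<^sup>2)" for a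
    by (simp add: norm_power2_rows compress_rows_def)
  have row: "integrable M (\<lambda>a. (norm (Q (A $ i) (Y i a) - A $ i))\<^sup>2)"
    "expectation (\<lambda>a. (norm (Q (A $ i) (Y i a) - A $ i))\<^sup>2) \<le> (1 - \<omega>) * (norm (A $ i))\<^sup>2" for i
  proof -
    let ?f = "\<lambda>s. (norm (Q (A $ i) s - A $ i))\<^sup>2"
    have f: "?f \<in> borel_measurable S"
      using Q_int by (rule borel_measurable_integrable)
    show "integrable M (\<lambda>a. ?f (Y i a))"
      using integrable_distr_eq[OF Y f] Q_int law by metis
    show "expectation (\<lambda>a. ?f (Y i a)) \<le> (1 - \<omega>) * (norm (A $ i))\<^sup>2"
      using integral_distr[OF Y f] Q_le law by metis
  qed
  have sq_int: "integrable M (\<lambda>a. (norm (?E a))\<^sup>2)"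
    unfolding E_sq by (intro Bochner_Integration.integrable_sum row)
  have "expectation (\<lambda>a. (norm (?E a))\<^sup>2) \<le> (\<Sum>i\<in>UNIV. (1 - \<omega>) * (norm (A $ i))\<^sup>2)"
    unfolding E_sq using row by (subst Bochner_Integration.integral_sum) (auto intro: sum_mono)
  also have "\<dots> = (1 - \<omega>) * (norm A)\<^sup>2"
    by (simp add: norm_power2_rows[of A] sum_distrib_left)
  also have "\<dots> \<le> ((1 - \<omega> / 2) * norm A)\<^sup>2"
    unfolding power_mult_distrib by (intro mult_right_mono) (auto simp: power2_eq_square field_simps)
  finally have sq_le: "expectation (\<lambda>a. (norm (?E a))\<^sup>2) \<le> ((1 - \<omega> / 2) * norm A)\<^sup>2" .
  have E: "integrable M (\<lambda>a. norm (?E a))"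
    "expectation (\<lambda>a. norm (?E a)) \<le> sqrt (expectation (\<lambda>a. (norm (?E a))\<^sup>2))"
    using expectation_le_sqrt_second_moment[of "\<lambda>a. norm (?E a)"] E_meas sq_int by auto
  have "expectation (\<lambda>a. norm (?E a)) \<le> (1 - \<omega> / 2) * norm A"
    using \<omega> by (intro order.trans[OF E(2)] real_le_lsqrt sq_le) auto
  then show ?thesis
    using E(1) by (subst nn_integral_eq_integral) (auto intro: ennreal_leI)
qed

text \<open>
The input \<open>D\<close> is a function of the seeds used before time \<open>t\<close>, hence independent of those used at time \<open>t\<close>.
\<close>

lemma fresh_compression_error_le:
  fixes D :: "'a \<Rightarrow> real^'d^'n::finite" and \<zeta> :: "nat \<times> 'n \<Rightarrow> 'a \<Rightarrow> 'z"
  assumes Q: "randomized_compressor \<omega> S Q" and \<omega>: "\<omega> \<le> 1" and seeds: "fresh_seeds M S \<zeta>"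
    and F: "F \<in> PiM ({..<t} \<times> UNIV) (\<lambda>_. S) \<rightarrow>\<^sub>M borel"
    and D: "\<And>a. a \<in> space M \<Longrightarrow> D a = F (restrict (\<lambda>k. \<zeta> k a) ({..<t} \<times> UNIV))"
    and D_int: "integrable M (\<lambda>a. norm (D a))"
  shows "integrable M (\<lambda>a. norm (compress_rows Q (D a) (\<lambda>i. \<zeta> (t, i) a) - D a))"
    and "expectation (\<lambda>a. norm (compress_rows Q (D a) (\<lambda>i. \<zeta> (t, i) a) - D a))
      \<le> (1 - \<omega> / 2) * expectation (\<lambda>a. norm (D a))"
proof -
  let ?past = "{..<t} \<times> (UNIV :: 'n set)" and ?now = "{t} \<times> (UNIV :: 'n set)"
  let ?g = "\<lambda>d s. ennreal (norm (compress_rows Q (F d) (\<lambda>i. s (t, i)) - F d))"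
  let ?E = "\<lambda>a. compress_rows Q (D a) (\<lambda>i. \<zeta> (t, i) a) - D a"
  have Q_meas: "(\<lambda>(x, s). Q x s) \<in> borel \<Otimes>\<^sub>M S \<rightarrow>\<^sub>M borel"
    using Q unfolding randomized_compressor_def by auto
  have indep: "indep_vars (\<lambda>_. S) \<zeta> UNIV" and law: "\<And>k. distr M S (\<zeta> k) = S"
    using seeds unfolding fresh_seeds_def by auto
  have \<zeta>: "\<zeta> k \<in> M \<rightarrow>\<^sub>M S" for k
    using indep by (simp add: indep_vars_def del: split_paired_All)
  have past: "(\<lambda>a. restrict (\<lambda>k. \<zeta> k a) ?past) \<in> M \<rightarrow>\<^sub>M PiM ?past (\<lambda>_. S)"
    by (intro measurable_restrict \<zeta>)
  have D_meas: "D \<in> borel_measurable M"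
    using measurable_compose[OF past F] D by (simp cong: measurable_cong)
  have E_meas: "?E \<in> borel_measurable M"
    by (intro borel_measurable_diff borel_measurable_compress_rows[OF Q_meas] D_meas \<zeta>)
  have F1: "(\<lambda>z. F (fst z)) \<in> borel_measurable (PiM ?past (\<lambda>_. S) \<Otimes>\<^sub>M PiM ?now (\<lambda>_. S))"
    by (rule measurable_compose[OF measurable_fst F])
  have seed: "(\<lambda>z. snd z (t, i)) \<in> PiM ?past (\<lambda>_. S) \<Otimes>\<^sub>M PiM ?now (\<lambda>_. S) \<rightarrow>\<^sub>M S" for i
    by (rule measurable_compose[OF measurable_snd measurable_component_singleton]) simp
  have "(\<lambda>z. compress_rows Q (F (fst z)) (\<lambda>i. snd z (t, i)) - F (fst z))
      \<in> borel_measurable (PiM ?past (\<lambda>_. S) \<Otimes>\<^sub>M PiM ?now (\<lambda>_. S))"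
    by (intro borel_measurable_diff borel_measurable_compress_rows[OF Q_meas] F1 seed)
  then have g: "case_prod ?g \<in> borel_measurable (PiM ?past (\<lambda>_. S) \<Otimes>\<^sub>M PiM ?now (\<lambda>_. S))"
    unfolding split_beta'
    by (intro measurable_compose[OF _ measurable_ennreal] measurable_compose[OF _ borel_measurable_norm])
  have "(\<integral>\<^sup>+ a. ?g (restrict (\<lambda>k. \<zeta> k a) ?past) (restrict (\<lambda>k. \<zeta> k a) ?now) \<partial>M)
      \<le> (\<integral>\<^sup>+ a. ennreal ((1 - \<omega> / 2) * norm (F (restrict (\<lambda>k. \<zeta> k a) ?past))) \<partial>M)"
  proof (rule indep_var_nn_integral_le[OF indep_var_restrict[OF indep] g])
    show "?past \<inter> ?now = {}" by auto
    show "(\<integral>\<^sup>+ a. ?g d (restrict (\<lambda>k. \<zeta> k a) ?now) \<partial>M) \<le> ennreal ((1 - \<omega> / 2) * norm (F d))" for d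
      using compression_error_le[OF Q \<omega>, of "\<lambda>i. \<zeta> (t, i)" "F d"] \<zeta> law by simp
  qed auto
  also have "(\<integral>\<^sup>+ a. ?g (restrict (\<lambda>k. \<zeta> k a) ?past) (restrict (\<lambda>k. \<zeta> k a) ?now) \<partial>M)
      = (\<integral>\<^sup>+ a. ennreal (norm (?E a)) \<partial>M)"
    by (intro nn_integral_cong) (simp add: D)
  also have "(\<integral>\<^sup>+ a. ennreal ((1 - \<omega> / 2) * norm (F (restrict (\<lambda>k. \<zeta> k a) ?past))) \<partial>M)
      = (\<integral>\<^sup>+ a. ennreal ((1 - \<omega> / 2) * norm (D a)) \<partial>M)"
    by (intro nn_integral_cong) (simp add: D)
  also have "\<dots> = ennreal (expectation (\<lambda>a. (1 - \<omega> / 2) * norm (D a)))"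
    using D_int \<omega> by (intro nn_integral_eq_integral) auto
  finally have le: "(\<integral>\<^sup>+ a. ennreal (norm (?E a)) \<partial>M)
      \<le> ennreal ((1 - \<omega> / 2) * expectation (\<lambda>a. norm (D a)))"
    by simp
  show int: "integrable M (\<lambda>a. norm (?E a))"
    using E_meas le by (intro integrableI_bounded) (auto intro: le_less_trans)
  have "ennreal (expectation (\<lambda>a. norm (?E a))) \<le> ennreal ((1 - \<omega> / 2) * expectation (\<lambda>a. norm (D a)))"
    using le nn_integral_eq_integral[OF int] by simp
  then show "expectation (\<lambda>a. norm (?E a)) \<le> (1 - \<omega> / 2) * expectation (\<lambda>a. norm (D a))"
    using \<omega> by (subst (asm) ennreal_le_iff) (auto intro!: mult_nonneg_nonneg integral_nonneg)
qed

end

text \<open>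
Both iterates at time \<open>t\<close> are measurable functions of the seeds used before time \<open>t\<close>. The functions are
built along the recursion, each reading only those coordinates of a longer history that it
needs.
\<close>

lemma state_function_of_past_seeds:
  fixes X Xhat :: "nat \<Rightarrow> 'a \<Rightarrow> real^'d^'n::finite" and \<zeta> :: "nat \<times> 'n \<Rightarrow> 'a \<Rightarrow> 'z"
    and B :: "real^'n^'n"
  assumes Q: "(\<lambda>(x, s). Q x s) \<in> borel \<Otimes>\<^sub>M S \<rightarrow>\<^sub>M borel"
    and X_0: "\<And>a. a \<in> \<Omega> \<Longrightarrow> X 0 a = X0" and Xhat_0: "\<And>a. a \<in> \<Omega> \<Longrightarrow> Xhat 0 a = Xhat0"
    and Xhat_step: "\<And>t a. a \<in> \<Omega> \<Longrightarrow>
      Xhat (Suc t) a = Xhat t a + compress_rows Q (X t a - Xhat t a) (\<lambda>i. \<zeta> (t, i) a)"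
    and X_step: "\<And>t a. a \<in> \<Omega> \<Longrightarrow> X (Suc t) a = X t a + \<gamma> *\<^sub>R (B ** Xhat (Suc t) a)"
  shows "\<exists>F G. F \<in> PiM ({..<t} \<times> UNIV) (\<lambda>_. S) \<rightarrow>\<^sub>M borel \<and> G \<in> PiM ({..<t} \<times> UNIV) (\<lambda>_. S) \<rightarrow>\<^sub>M borel \<and>
    (\<forall>a\<in>\<Omega>. X t a = F (restrict (\<lambda>k. \<zeta> k a) ({..<t} \<times> UNIV)) \<and>
          Xhat t a = G (restrict (\<lambda>k. \<zeta> k a) ({..<t} \<times> UNIV)))"
proof (induction t)
  case 0
  show ?case
    by (rule exI[of _ "\<lambda>_. X0"], rule exI[of _ "\<lambda>_. Xhat0"]) (simp add: X_0 Xhat_0)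
next
  case (Suc t)
  let ?past = "{..<t} \<times> (UNIV :: 'n set)" and ?past' = "{..<Suc t} \<times> (UNIV :: 'n set)"
  let ?N = "PiM ?past' (\<lambda>_. S)"
  obtain F G where F: "F \<in> PiM ?past (\<lambda>_. S) \<rightarrow>\<^sub>M borel" and G: "G \<in> PiM ?past (\<lambda>_. S) \<rightarrow>\<^sub>M borel"
    and FG: "\<And>a. a \<in> \<Omega> \<Longrightarrow> X t a = F (restrict (\<lambda>k. \<zeta> k a) ?past)"
      "\<And>a. a \<in> \<Omega> \<Longrightarrow> Xhat t a = G (restrict (\<lambda>k. \<zeta> k a) ?past)"
    using Suc.IH by blast
  define F1 where "F1 = (\<lambda>s. F (restrict s ?past))"
  define G1 where "G1 = (\<lambda>s. G (restrict s ?past))"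
  define G' where "G' = (\<lambda>s. G1 s + compress_rows Q (F1 s - G1 s) (\<lambda>i. s (t, i)))"
  define F' where "F' = (\<lambda>s. F1 s + \<gamma> *\<^sub>R (B ** G' s))"
  have restr: "(\<lambda>s. restrict s ?past) \<in> ?N \<rightarrow>\<^sub>M PiM ?past (\<lambda>_. S)"
    by (rule measurable_restrict_subset) auto
  have F1: "F1 \<in> borel_measurable ?N" and G1: "G1 \<in> borel_measurable ?N"
    unfolding F1_def G1_def using measurable_compose[OF restr F] measurable_compose[OF restr G] by auto
  have seed: "(\<lambda>s. s (t, i)) \<in> ?N \<rightarrow>\<^sub>M S" for i
    by (rule measurable_component_singleton) simp
  have G': "G' \<in> borel_measurable ?N"
    unfolding G'_def
    by (intro borel_measurable_add borel_measurable_compress_rows[OF Q] borel_measurable_diff F1 G1 seed)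
  have mult: "(\<lambda>A :: real^'d^'n. B ** A) \<in> borel_measurable borel"
    by (intro borel_measurable_continuous_onI linear_continuous_on matmul.bounded_linear_right)
  have F': "F' \<in> borel_measurable ?N"
    unfolding F'_def
    by (intro borel_measurable_add F1 borel_measurable_scaleR borel_measurable_const
        measurable_compose[OF G' mult])
  have sub: "?past' \<inter> ?past = ?past"
    by auto
  have now: "Xhat (Suc t) a = G' (restrict (\<lambda>k. \<zeta> k a) ?past')" if "a \<in> \<Omega>" for a
    using that by (simp add: Xhat_step FG G'_def F1_def G1_def sub)
  have "X (Suc t) a = F' (restrict (\<lambda>k. \<zeta> k a) ?past')" if "a \<in> \<Omega>" for a
    using that by (simp add: X_step now FG F'_def F1_def sub)
  with now F' G' show ?case by blast
qed

section \<open>Removing the bias of the stationary vector\<close>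

text \<open>
With \<open>y = W *v 1\<close>, row \<open>i\<close> of the error is \<open>(x\<^sub>i - y\<^sub>i m) / y\<^sub>i\<close>, where \<open>m\<close> is the mean row of \<open>A0\<close>. The rows
\<open>y\<^sub>i m\<close> form the matrix \<open>W ** avg A0\<close>, and \<open>P ** avg A0 = P ** A0\<close>; so the numerators measure how far \<open>A\<close> is
from \<open>P ** A0\<close> and how far \<open>W\<close> is from \<open>P\<close>. In the application \<open>W\<close> is a power of the mixing matrix.
\<close>

lemma debiasing_error_le:
  fixes A Z :: "real^'d^'n::finite" and W :: "real^'n^'n" and \<phi> :: "real^'n"
  defines "P \<equiv> columnvector \<phi> ** (rowvector 1 :: real^'n^1)"
  defines "avg \<equiv> \<lambda>B :: real^'d^'n. (1 / real CARD('n)) *\<^sub>R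
    ((columnvector (1 :: real^'n) ** (rowvector 1 :: real^'n^1)) ** B)"
  assumes \<kappa>: "0 < \<kappa>" and y: "\<And>i. \<kappa> \<le> (W *v 1) $ i"
    and Z: "\<And>i. Z $ i = A $ i /\<^sub>R (W *v 1) $ i"
  shows "norm (Z - avg A0) \<le> (norm (A - P ** A0) + spectral_norm (W - P) * norm A0) / \<kappa>"
proof -
  let ?y = "W *v 1" and ?m = "(1 / real CARD('n)) *\<^sub>R (\<Sum>k\<in>UNIV. A0 $ k)"
  define T where "T = (A - P ** A0) - (W - P) ** avg A0"
  have avg: "avg A0 $ i = ?m" for i
    by (simp add: avg_def vec_eq_iff matrix_matrix_mult_def columnvector_def rowvector_def UNIV_1)
  have P_avg: "P ** avg A0 = P ** A0"
    unfolding P_def matrix_mul_assoc[symmetric]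
    by (rule arg_cong[where f = "\<lambda>B. columnvector \<phi> ** B"])
       (simp add: vec_eq_iff matrix_matrix_mult_def rowvector_def avg)
  have W_avg: "(W ** avg A0) $ i = ?y $ i *\<^sub>R ?m" for i
    by (simp add: vec_eq_iff matrix_matrix_mult_def matrix_vector_mult_def avg sum_distrib_right
        flip: sum_divide_distrib)
  have T: "T $ i = A $ i - ?y $ i *\<^sub>R ?m" for i
    by (simp add: T_def matmul.diff_left P_avg W_avg)
  have row: "norm ((Z - avg A0) $ i) \<le> norm (T $ i) / \<kappa>" for i
  proof -
    have pos: "0 < ?y $ i" using \<kappa> y[of i] by linarith
    then have "(Z - avg A0) $ i = T $ i /\<^sub>R ?y $ i"
      by (simp add: Z avg T scaleR_right_diff_distrib)
    then have "norm ((Z - avg A0) $ i) = norm (T $ i) / ?y $ i"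
      using pos by (simp add: divide_inverse mult.commute)
    also have "\<dots> \<le> norm (T $ i) / \<kappa>"
      using \<kappa> y[of i] by (intro divide_left_mono) auto
    finally show ?thesis .
  qed
  have "norm (Z - avg A0) \<le> norm ((1 / \<kappa>) *\<^sub>R T)"
    by (rule norm_le_componentwise_cart) (use row \<kappa> in simp)
  also have "\<dots> = norm T / \<kappa>"
    using \<kappa> by simp
  also have "norm T \<le> norm (A - P ** A0) + spectral_norm (W - P) * norm A0"
    unfolding T_def avg_def
    by (intro order.trans[OF norm_triangle_ineq4] add_left_mono order.trans[OF norm_matrix_mult_le]
        mult_left_mono norm_row_average_le spectral_norm_nonneg)
  finally show ?thesis
    using \<kappa> by (simp add: divide_right_mono)
qed

section \<open>Convergence of compressed push-sum\<close>

theorem theorem1: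
  fixes E :: "('n::finite \<times> 'n) set"
    and W :: "real^'n^'n"
    and \<phi> :: "real^'n"
    and \<delta> C \<kappa> \<beta> \<omega> \<gamma> \<rho> C\<^sub>0 :: real
    and S :: "'z measure"
    and Q :: "real^'d::finite \<Rightarrow> 'z \<Rightarrow> real^'d"
    and M :: "'a measure"
    and \<zeta> :: "nat \<times> 'n \<Rightarrow> 'a \<Rightarrow> 'z"
    and X0 Xbar0 :: "real^'d^'n"
    and X Xhat Z :: "nat \<Rightarrow> 'a \<Rightarrow> real^'d^'n"
    and y :: "nat \<Rightarrow> real^'n"
  assumes graph: "strongly_connected_arcs E"
    and W_range: "\<And>i j. 0 \<le> W $ i $ j \<and> W $ i $ j \<le> 1"
    and W_column_stochastic: "1 v* W = 1"
    and W_consistent: "\<And>i j. i \<noteq> j \<Longrightarrow> (j, i) \<notin> E \<Longrightarrow> W $ i $ j = 0"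
    and beta: "\<beta> = spectral_norm (W - mat 1)"
    and delta: "0 < \<delta>" "\<delta> \<le> 1"
    and C_pos: "0 < C"
    and kappa_pos: "0 < \<kappa>"
    and phi_stochastic: "\<And>i. 0 \<le> \<phi> $ i" "(\<Sum>i\<in>UNIV. \<phi> $ i) = 1"
    and phi_fixed: "W *v \<phi> = \<phi>"
    and W_power_lower: "\<And>t i. \<kappa> \<le> (matrix_power W t *v 1) $ i"
    and W_power_mixing:
      "\<And>t. spectral_norm (matrix_power W t - columnvector \<phi> ** (rowvector 1 :: real^'n^1))
            \<le> C * (1 - \<delta>) ^ t"
    and omega: "0 < \<omega>" "\<omega> \<le> 1"
    and compressor: "randomized_compressor \<omega> S Q"
    and prob: "prob_space M"
    and seeds: "fresh_seeds M S \<zeta>"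
    and gamma: "\<gamma> = 2 * \<omega> * \<delta> / (8 * \<beta> * \<delta> + 4 * \<beta>\<^sup>2 * C + 4 * \<omega> * \<delta>\<^sup>2)"
    and gamma_range: "0 < \<gamma>" "\<gamma> \<le> 1"
    and X_init: "\<And>a. a \<in> space M \<Longrightarrow> X 0 a = X0"
    and Xhat_init: "\<And>a. a \<in> space M \<Longrightarrow> Xhat 0 a = 0"
    and y_init: "y 0 = 1"
    and Xhat_step: "\<And>t a. a \<in> space M \<Longrightarrow>
      Xhat (t + 1) a = Xhat t a + compress_rows Q (X t a - Xhat t a) (\<lambda>i. \<zeta> (t, i) a)"
    and X_step: "\<And>t a. a \<in> space M \<Longrightarrow>
      X (t + 1) a = X t a + \<gamma> *\<^sub>R ((W - mat 1) ** Xhat (t + 1) a)"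
    and y_step: "\<And>t. y (t + 1) = W *v y t"
    and Z_def: "\<And>t a i. a \<in> space M \<Longrightarrow>
      Z (t + 1) a $ i = X (t + 1) a $ i /\<^sub>R y (t + 1) $ i"
    and Xbar0: "Xbar0 = (1 / real CARD('n)) *\<^sub>R
      ((columnvector (1 :: real^'n) ** (rowvector 1 :: real^'n^1)) ** X0)"
    and rho: "\<rho> = 1 - \<omega>\<^sup>2 * \<delta>\<^sup>2 / (16 * \<beta> * \<delta> + 8 * \<beta>\<^sup>2 * C + 8 * \<omega> * \<delta>\<^sup>2)"
    and C0: "C\<^sub>0 = 4 * real CARD('n) * C * (1 + \<beta> * C) * norm X0 / (\<kappa> * \<delta>)"
  shows "\<forall>t\<ge>1. integrable M (\<lambda>a. norm (Z t a - Xbar0)) \<and>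
    (\<integral>a. norm (Z t a - Xbar0) \<partial>M) \<le> C\<^sub>0 * \<rho> ^ t"
proof -
  interpret prob_space M by (rule prob)
  \<comment> \<open>\<open>P ** X0\<close> is the limit of the iterates, \<open>U\<close> the compression error, and \<open>R\<close> the pathwise bound for the
      disagreement, driven by the norms of the compression errors.\<close>
  define P where "P = columnvector \<phi> ** (rowvector 1 :: real^'n^1)"
  define U where "U = (\<lambda>t a. compress_rows Q (X t a - Xhat t a) (\<lambda>i. \<zeta> (t, i) a) - (X t a - Xhat t a))"
  define R where "R = (\<lambda>a. rec_nat (C * norm X0)
    (\<lambda>t r. (1 - \<gamma> * \<delta>) * r + \<gamma> * \<beta> * C * norm (U t a)))"
  have R_0: "R a 0 = C * norm X0"
    and R_Suc: "R a (Suc t) = (1 - \<gamma> * \<delta>) * R a t + \<gamma> * \<beta> * C * norm (U t a)" for a t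
    by (simp_all add: R_def)
  have mixing: "spectral_norm (matrix_power W j - P) \<le> C * (1 - \<delta>) ^ j" for j
    unfolding P_def by (rule W_power_mixing)
  have WP: "W ** P = P"
    unfolding P_def matrix_mul_assoc by (simp add: phi_fixed flip: dot_rowvector_columnvector)
  have PW: "P ** W = P"
  proof -
    have "(rowvector 1 :: real^'n^1) ** W = rowvector (1 v* W)"
      by (simp add: vec_eq_iff rowvector_def matrix_matrix_mult_def vector_matrix_mult_def mult.commute)
    then show ?thesis
      unfolding P_def matrix_mul_assoc[symmetric] by (simp add: W_column_stochastic)
  qed
  have \<beta>: "0 \<le> \<beta>" "\<beta> \<le> 2 * C"
    unfolding beta using spectral_norm_nonneg spectral_norm_diff_mat_1_le[OF mixing] delta C_pos by auto
  have X_U: "X (Suc t) a = X t a + \<gamma> *\<^sub>R ((W - mat 1) ** (X t a + U t a))" if "a \<in> space M" for t a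
    using X_step[OF that, of t] Xhat_step[OF that, of t] by (simp add: U_def add_ac)
  have dev: "norm (X t a - P ** X0) \<le> R a t" if a: "a \<in> space M" for t a
  proof -
    have "norm (X t a - P ** X 0 a) \<le> R a t"
      using gamma_range
      by (intro disagreement_bound[where U = "\<lambda>t. U t a" and \<gamma> = \<gamma>, OF mixing WP PW])
         (auto simp: X_U a R_0 R_Suc X_init beta)
    then show ?thesis by (simp add: X_init a)
  qed
  \<comment> \<open>In the lag the mixing step sees \<open>X t a\<close> only through its deviation from the limit, since \<open>W - mat 1\<close>
      annihilates \<open>P\<close>.\<close>
  have lag: "norm (X (Suc t) a - Xhat (Suc t) a)
      \<le> (1 + \<gamma> * \<beta>) * norm (U t a) + \<gamma> * \<beta> * R a t" if a: "a \<in> space M" for t a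
  proof -
    have WI: "(W - mat 1) ** X t a = (W - mat 1) ** (X t a - P ** X0)"
      by (simp add: matmul.diff_right matmul.diff_left matrix_mul_assoc WP)
    have "X (Suc t) a - Xhat (Suc t) a
        = \<gamma> *\<^sub>R ((W - mat 1) ** U t a) - U t a + \<gamma> *\<^sub>R ((W - mat 1) ** (X t a - P ** X0))"
      using Xhat_step[OF a, of t]
      by (simp add: X_U[OF a] matmul.add_right WI scaleR_add_right) (simp add: U_def)
    also have "norm \<dots> \<le> (\<gamma> * norm ((W - mat 1) ** U t a) + norm (U t a))
        + \<gamma> * norm ((W - mat 1) ** (X t a - P ** X0))"
      using gamma_range(1)
      by (intro order.trans[OF norm_triangle_ineq] add_mono order.trans[OF norm_triangle_ineq4]) auto
    also have "\<dots> \<le> (\<gamma> * (\<beta> * norm (U t a)) + norm (U t a)) + \<gamma> * (\<beta> * R a t)"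
      using gamma_range(1) \<beta>(1) unfolding beta
      by (intro add_mono mult_left_mono norm_matrix_mult_le order.refl
          order.trans[OF norm_matrix_mult_le] dev[OF a]) auto
    also have "\<dots> = (1 + \<gamma> * \<beta>) * norm (U t a) + \<gamma> * \<beta> * R a t"
      by (simp add: algebra_simps)
    finally show ?thesis .
  qed
  have Q_meas: "(\<lambda>(x, s). Q x s) \<in> borel \<Otimes>\<^sub>M S \<rightarrow>\<^sub>M borel"
    using compressor unfolding randomized_compressor_def by auto
  have seed: "\<zeta> k \<in> M \<rightarrow>\<^sub>M S" for k
    using seeds by (simp add: fresh_seeds_def indep_vars_def del: split_paired_All)
  have past: "(\<lambda>a. restrict (\<lambda>k. \<zeta> k a) ({..<t} \<times> UNIV)) \<in> M \<rightarrow>\<^sub>M PiM ({..<t} \<times> UNIV) (\<lambda>_. S)" for t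
    by (intro measurable_restrict seed)
  have state: "\<exists>F G. F \<in> PiM ({..<t} \<times> UNIV) (\<lambda>_. S) \<rightarrow>\<^sub>M borel \<and> G \<in> PiM ({..<t} \<times> UNIV) (\<lambda>_. S) \<rightarrow>\<^sub>M borel \<and>
    (\<forall>a\<in>space M. X t a = F (restrict (\<lambda>k. \<zeta> k a) ({..<t} \<times> UNIV)) \<and>
          Xhat t a = G (restrict (\<lambda>k. \<zeta> k a) ({..<t} \<times> UNIV)))" for t
    using Xhat_step X_step
    by (intro state_function_of_past_seeds[where X = X and Xhat = Xhat
          and \<Omega> = "space M" and \<gamma> = \<gamma> and B = "W - mat 1", OF Q_meas X_init Xhat_init]) auto
  have X_meas: "X t \<in> borel_measurable M" and Xhat_meas: "Xhat t \<in> borel_measurable M" for t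
  proof -
    obtain F G where "F \<in> PiM ({..<t} \<times> UNIV) (\<lambda>_. S) \<rightarrow>\<^sub>M borel" "G \<in> PiM ({..<t} \<times> UNIV) (\<lambda>_. S) \<rightarrow>\<^sub>M borel"
      and eq: "\<And>a. a \<in> space M \<Longrightarrow> X t a = F (restrict (\<lambda>k. \<zeta> k a) ({..<t} \<times> UNIV))"
        "\<And>a. a \<in> space M \<Longrightarrow> Xhat t a = G (restrict (\<lambda>k. \<zeta> k a) ({..<t} \<times> UNIV))"
      using state[of t] by blast
    then show "X t \<in> borel_measurable M" "Xhat t \<in> borel_measurable M"
      using measurable_compose[OF past] by (auto simp: eq cong: measurable_cong)
  qed
  have U_int: "integrable M (\<lambda>a. norm (U t a))"
    and U_le: "expectation (\<lambda>a. norm (U t a)) \<le> (1 - \<omega> / 2) * expectation (\<lambda>a. norm (X t a - Xhat t a))"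
    if D_int: "integrable M (\<lambda>a. norm (X t a - Xhat t a))" for t
  proof -
    obtain F G where F: "F \<in> PiM ({..<t} \<times> UNIV) (\<lambda>_. S) \<rightarrow>\<^sub>M borel" and G: "G \<in> PiM ({..<t} \<times> UNIV) (\<lambda>_. S) \<rightarrow>\<^sub>M borel"
      and eq: "\<And>a. a \<in> space M \<Longrightarrow> X t a = F (restrict (\<lambda>k. \<zeta> k a) ({..<t} \<times> UNIV))"
        "\<And>a. a \<in> space M \<Longrightarrow> Xhat t a = G (restrict (\<lambda>k. \<zeta> k a) ({..<t} \<times> UNIV))"
      using state[of t] by blast
    have FG: "(\<lambda>s. F s - G s) \<in> PiM ({..<t} \<times> UNIV) (\<lambda>_. S) \<rightarrow>\<^sub>M borel"
      by (intro borel_measurable_diff F G)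
    show "integrable M (\<lambda>a. norm (U t a))"
      "expectation (\<lambda>a. norm (U t a)) \<le> (1 - \<omega> / 2) * expectation (\<lambda>a. norm (X t a - Xhat t a))"
      unfolding U_def
      by (rule fresh_compression_error_le[OF compressor omega(2) seeds FG]; simp add: eq D_int)+
  qed
  have R_int: "integrable M (\<lambda>a. R a t)" and D_int: "integrable M (\<lambda>a. norm (X t a - Xhat t a))" for t
  proof (induction t)
    case 0
    have "integrable M (\<lambda>a. norm (X 0 a - Xhat 0 a)) \<longleftrightarrow> integrable M (\<lambda>a. norm X0)"
      by (rule Bochner_Integration.integrable_cong) (simp_all add: X_init Xhat_init)
    then show "integrable M (\<lambda>a. R a 0)" "integrable M (\<lambda>a. norm (X 0 a - Xhat 0 a))"
      by (simp_all add: R_0)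
  next
    case (Suc t)
    note int = Suc.IH(1) U_int[OF Suc.IH(2)]
    show "integrable M (\<lambda>a. R a (Suc t))"
      unfolding R_Suc using int by (intro Bochner_Integration.integrable_add integrable_mult_right)
    have bound: "integrable M (\<lambda>a. (1 + \<gamma> * \<beta>) * norm (U t a) + \<gamma> * \<beta> * R a t)"
      using int by (intro Bochner_Integration.integrable_add integrable_mult_right)
    have meas: "(\<lambda>a. norm (X (Suc t) a - Xhat (Suc t) a)) \<in> borel_measurable M"
      using X_meas Xhat_meas by measurable
    show "integrable M (\<lambda>a. norm (X (Suc t) a - Xhat (Suc t) a))"
      by (rule Bochner_Integration.integrable_bound[OF bound meas])
         (auto intro!: AE_I2 order.trans[OF lag])
  qed
  define e where "e = (\<lambda>t. expectation (\<lambda>a. norm (X t a - Xhat t a)))"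
  define r where "r = (\<lambda>t. expectation (\<lambda>a. R a t))"
  have e_0: "e 0 = norm X0"
  proof -
    have "e 0 = expectation (\<lambda>a. norm X0)"
      unfolding e_def by (rule Bochner_Integration.integral_cong) (simp_all add: X_init Xhat_init)
    then show ?thesis by (simp add: prob_space)
  qed
  have r_0: "r 0 = C * norm X0"
    by (simp add: r_def R_0 prob_space)
  have r_nonneg: "0 \<le> r t" for t
    unfolding r_def using dev by (intro integral_nonneg_AE AE_I2) (meson norm_ge_zero order.trans)
  have r_step: "r (Suc t) \<le> (1 - \<gamma> * \<delta>) * r t + \<gamma> * \<beta> * C * (1 - \<omega> / 2) * e t" for t
  proof -
    have "r (Suc t) = (1 - \<gamma> * \<delta>) * r t + \<gamma> * \<beta> * C * expectation (\<lambda>a. norm (U t a))"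
      unfolding r_def R_Suc using R_int U_int[OF D_int] by simp
    also have "\<dots> \<le> (1 - \<gamma> * \<delta>) * r t + \<gamma> * \<beta> * C * ((1 - \<omega> / 2) * e t)"
      unfolding e_def using gamma_range \<beta> C_pos
      by (intro add_left_mono mult_left_mono U_le D_int) auto
    finally show ?thesis by (simp add: mult_ac)
  qed
  have e_step: "e (Suc t) \<le> (1 + \<gamma> * \<beta>) * (1 - \<omega> / 2) * e t + \<gamma> * \<beta> * r t" for t
  proof -
    have "e (Suc t) \<le> expectation (\<lambda>a. (1 + \<gamma> * \<beta>) * norm (U t a) + \<gamma> * \<beta> * R a t)"
      unfolding e_def using R_int U_int[OF D_int]
      by (intro integral_mono D_int lag Bochner_Integration.integrable_add integrable_mult_right)
    also have "\<dots> = (1 + \<gamma> * \<beta>) * expectation (\<lambda>a. norm (U t a)) + \<gamma> * \<beta> * r t"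
      unfolding r_def using R_int U_int[OF D_int] by simp
    also have "\<dots> \<le> (1 + \<gamma> * \<beta>) * ((1 - \<omega> / 2) * e t) + \<gamma> * \<beta> * r t"
      unfolding e_def using gamma_range \<beta> by (intro add_right_mono mult_left_mono U_le D_int) auto
    finally show ?thesis by (simp add: mult_ac)
  qed
  have rate: "r t + C * (1 - \<delta>) ^ t * norm X0 \<le> 4 * C * (1 + \<beta> * C) * norm X0 / \<delta> * \<rho> ^ t" for t
    by (rule coupled_recursion_decay[OF omega delta \<beta> C_pos norm_ge_zero gamma rho _ r_nonneg e_0 r_0
          e_step r_step gamma_range(2)]) (simp add: e_def)
  show ?thesis
  proof (intro allI impI)
    fix t :: nat
    assume "1 \<le> t"
    then obtain s where s: "t = Suc s" by (cases t) auto
    have y: "y t = matrix_power W t *v 1" for t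
    proof (induction t)
      case (Suc t)
      then show ?case using y_step[of t] by (simp add: matrix_vector_mul_assoc)
    qed (simp add: y_init)
    have Z_eq: "Z t a $ i = X t a $ i /\<^sub>R y t $ i" if "a \<in> space M" for a i
      using Z_def[OF that, of s i] by (simp add: s)
    have Z_le: "norm (Z t a - Xbar0) \<le> (R a t + C * (1 - \<delta>) ^ t * norm X0) / \<kappa>"
      if a: "a \<in> space M" for a
    proof -
      have "norm (Z t a - Xbar0)
          \<le> (norm (X t a - P ** X0) + spectral_norm (matrix_power W t - P) * norm X0) / \<kappa>"
        unfolding Xbar0 P_def
        by (rule debiasing_error_le[OF kappa_pos W_power_lower]) (simp add: Z_eq[OF a] y)
      also have "\<dots> \<le> (R a t + C * (1 - \<delta>) ^ t * norm X0) / \<kappa>"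
        using kappa_pos by (intro divide_right_mono add_mono mult_right_mono dev[OF a] mixing) auto
      finally show ?thesis .
    qed
    have Z_meas: "Z t \<in> borel_measurable M"
    proof -
      have row: "(\<lambda>A :: real^'d^'n. A $ i /\<^sub>R y t $ i) \<in> borel_measurable borel" for i
        by (intro borel_measurable_continuous_onI continuous_intros)
      have "(\<lambda>a. \<chi> i. X t a $ i /\<^sub>R y t $ i) \<in> borel_measurable M"
        by (intro borel_measurable_vec_lambda measurable_compose[OF X_meas row])
      moreover have "Z t a = (\<chi> i. X t a $ i /\<^sub>R y t $ i)" if "a \<in> space M" for a
        by (simp add: vec_eq_iff Z_eq[OF that])
      ultimately show ?thesis by (simp cong: measurable_cong)
    qed
    have bound: "integrable M (\<lambda>a. (R a t + C * (1 - \<delta>) ^ t * norm X0) / \<kappa>)"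
      using R_int[of t] by simp
    have int: "integrable M (\<lambda>a. norm (Z t a - Xbar0))"
      by (rule Bochner_Integration.integrable_bound[OF bound])
         (use Z_meas in \<open>auto intro!: AE_I2 order.trans[OF Z_le abs_ge_self] simp del: abs_divide\<close>)
    have "expectation (\<lambda>a. norm (Z t a - Xbar0))
        \<le> expectation (\<lambda>a. (R a t + C * (1 - \<delta>) ^ t * norm X0) / \<kappa>)"
      by (rule integral_mono[OF int bound Z_le])
    also have "\<dots> = (r t + C * (1 - \<delta>) ^ t * norm X0) / \<kappa>"
      unfolding r_def using R_int[of t] by (simp add: prob_space)
    also have "\<dots> \<le> real CARD('n) * ((r t + C * (1 - \<delta>) ^ t * norm X0) / \<kappa>)"
    proof -
      have "1 * ((r t + C * (1 - \<delta>) ^ t * norm X0) / \<kappa>)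
          \<le> real CARD('n) * ((r t + C * (1 - \<delta>) ^ t * norm X0) / \<kappa>)"
        using r_nonneg C_pos delta kappa_pos by (intro mult_right_mono) (auto simp: Suc_le_eq)
      then show ?thesis by simp
    qed
    also have "\<dots> \<le> real CARD('n) * (4 * C * (1 + \<beta> * C) * norm X0 / \<delta> * \<rho> ^ t / \<kappa>)"
      using kappa_pos by (intro mult_left_mono divide_right_mono rate) auto
    also have "\<dots> = C\<^sub>0 * \<rho> ^ t"
      by (simp add: C0 mult_ac)
    finally show "integrable M (\<lambda>a. norm (Z t a - Xbar0)) \<and>
        expectation (\<lambda>a. norm (Z t a - Xbar0)) \<le> C\<^sub>0 * \<rho> ^ t"
      using int by blast
  qed
qed

end
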